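(* Suppose there are exactly $3$ potential input values, and let $G$ be a network whose largest component has $h$ processors. (a) If there exists a successful majority agreement protocol for $G$, then $h > \frac{|G|}{4}$. (b) Conversely, if $h > \frac{|G|}{4}$ and $\frac{|G|-h}{3} \in \mathbf{Z}$, then there exists a successful majority agreement protocol for $G$.
   Context: A network $G$ is a finite nonempty (possibly disconnected) undirected graph whose vertices are called processors; $|G|$ is the number of processors, and the size of a component (connected component) is its number of processors. Fix a set $V$ of $3$ (distinct) potential values. All processors know the whole network and the protocol. Each processor $i$ is given an input value $v_i \in V$ and may communicate without limit (and without faults), but only with the processors in its own component, after which it outputs a value in $V$. Thus a (deterministic) protocol amounts to choosing, for each processor $i$, a function giving the output of $i$ in $V$ in terms of the inputs of all the processors in the component of $i$ (and of no other inputs); these functions may be arbitrary and may differ between processors. A protocol is a successful majority agreement protocol if for every assignment of inputs $(v_i)$ there is a value $v \in V$ such that: (i) strictly more than $|G|/2$ of the processors output $v$; and (ii) if all processors have the same input $v_c$, then $v = v_c$. *)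

theory Defs
  imports Complex_Main "HOL-Library.FuncSet" "Graph_Theory.Digraph_Component"
begin

text \<open>
  Undirected graphs are the symmetric digraphs of the locale \<^locale>\<open>graph\<close>, whose strongly
  connected components are therefore the connected components; see
  \<open>component_eq_reachable\<close> and \<open>components_eq\<close> below.
\<close>

locale network = graph +
  assumes verts_nonempty: "verts G \<noteq> {}"

abbreviation component :: "('p, 'e) pre_digraph \<Rightarrow> 'p \<Rightarrow> 'p set" where
  "component \<equiv> pre_digraph.scc_of"

abbreviation components :: "('p, 'e) pre_digraph \<Rightarrow> 'p set set" where
  "components \<equiv> pre_digraph.sccs_verts"

definition largest_component_size :: "('p, 'e) pre_digraph \<Rightarrow> nat" where
  "largest_component_size G = Max (card ` components G)"

text \<open>
  An assignment of inputs to a set \<open>A\<close> of processors is an element of \<open>A \<rightarrow>\<^sub>E V\<close>. As such a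
  function is \<open>undefined\<close> off \<open>A\<close>, a function on \<open>component G i \<rightarrow>\<^sub>E V\<close> has no access to any
  input from outside the component of \<open>i\<close>.
\<close>

definition protocols ::
    "'v set \<Rightarrow> ('p, 'e) pre_digraph \<Rightarrow> ('p \<Rightarrow> ('p \<Rightarrow> 'v) \<Rightarrow> 'v) set" where
  "protocols V G = (\<Pi> i\<in>verts G. (component G i \<rightarrow>\<^sub>E V) \<rightarrow> V)"

definition proc_output ::
    "('p, 'e) pre_digraph \<Rightarrow> ('p \<Rightarrow> ('p \<Rightarrow> 'v) \<Rightarrow> 'v) \<Rightarrow> ('p \<Rightarrow> 'v) \<Rightarrow> 'p \<Rightarrow> 'v" where
  "proc_output G P inp i = P i (restrict inp (component G i))"

definition successful_majority_agreement ::
    "'v set \<Rightarrow> ('p, 'e) pre_digraph \<Rightarrow> ('p \<Rightarrow> ('p \<Rightarrow> 'v) \<Rightarrow> 'v) \<Rightarrow> bool" where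
  "successful_majority_agreement V G P \<longleftrightarrow>
     P \<in> protocols V G \<and>
     (\<forall>inp \<in> verts G \<rightarrow>\<^sub>E V. \<exists>v\<in>V.
        real (card {i \<in> verts G. proc_output G P inp i = v}) > real (card (verts G)) / 2 \<and>
        (\<forall>c\<in>V. (\<forall>i\<in>verts G. inp i = c) \<longrightarrow> v = c))"

context network
begin

lemma component_eq_reachable: "component G i = {j. i \<rightarrow>\<^sup>* j}"
  unfolding pre_digraph.scc_of_def using symmetric_reachable[OF sym_arcs] by blast

lemma components_eq: "components G = component G ` verts G"
  by (rule sccs_verts_conv_scc_of)

end

end

theory Submission
  imports Defs "HOL-Library.Numeral_Type"
begin

text \<open>
  For (b), a largest component is a dictator, and the other processors are split into
  three equally large groups, one for each value, whose outputs are constant.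

  For (a), let all processors of a component have the same input, so that an input is
  a point of \<open>V\<^sup>k\<close> (\<open>k\<close> the number of components), labelled by its majority output. Changing
  one coordinate changes every output count by at most \<open>|G|/4\<close>, so that no point and two of its
  neighbours can carry three different labels. Identify \<open>V\<close> with the integers modulo 3: the label
  then winds zero times around every triangle and every square of \<open>V\<^sup>k\<close>, and hence lifts to an
  integer-valued function \<open>g\<close>. It remains to see that \<open>g\<close> changes by 1 from each constant point
  to the next, which is absurd since the three changes add up to 0. This can only fail if the path
  from \<open>(a,...,a)\<close> to \<open>(b,...,b)\<close> which switches the coordinates one by one meets the third label.
  Run the complementary path (from \<open>b\<close> to \<open>a\<close>) in parallel: as the responses of the components add
  up, the sum \<open>S\<close> of the two output counts is constant along the way. All three entries of \<open>S\<close> then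
  exceed \<open>|G|/2\<close>, so the two paths never carry the same label at the same time. But the difference
  of \<open>g\<close> along the two paths changes its sign, so at some step the two labels are swapped,
  where the third entry of \<open>S\<close> is less than \<open>|G|/2\<close>.
\<close>

section \<open>Labels as integers modulo 3\<close>

lemma exhaust_mod3:
  fixes a :: 3
  shows "a = 0 \<or> a = 1 \<or> a = 2"
proof (induct a)
  case (of_int z)
  then have "z = 0 \<or> z = 1 \<or> z = 2" by simp arith
  then show ?case by auto
qed

lemma UNIV_mod3: "(UNIV :: 3 set) = {0, 1, 2}"
  using exhaust_mod3 by auto

lemma distinct_mod3: "(0::3) \<noteq> 1" "(1::3) \<noteq> 2" "(0::3) \<noteq> 2"
  by simp_all

lemma sum_mod3:
  fixes u v w :: 3
  assumes "u \<noteq> v" "v \<noteq> w" "u \<noteq> w"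
  shows "sum F UNIV = F u + F v + F w"
proof -
  have "(UNIV :: 3 set) = {u, v, w}"
    using exhaust_mod3[of u] exhaust_mod3[of v] exhaust_mod3[of w] assms
    unfolding UNIV_mod3 by auto
  then have "sum F UNIV = sum F {u, v, w}"
    by simp
  also have "\<dots> = F u + F v + F w"
    using assms by (simp add: add.assoc)
  finally show ?thesis .
qed

text \<open>The representative of \<open>b - a\<close> in {-1, 0, 1}: the signed step from
  \<open>a\<close> to \<open>b\<close> around the 3-cycle.\<close>

definition cyc_diff :: "3 \<Rightarrow> 3 \<Rightarrow> int" where
  "cyc_diff a b = (if b = a then 0 else if b = a + 1 then 1 else - 1)"

lemma of_int_cyc_diff: "of_int (cyc_diff a b) = b - a"
  using exhaust_mod3[of a] exhaust_mod3[of b] unfolding cyc_diff_def by auto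

lemma abs_cyc_diff_le: "\<bar>cyc_diff a b\<bar> \<le> 1"
  unfolding cyc_diff_def by auto

text \<open>A closed walk of three steps that misses a vertex of the 3-cycle cannot wind around
  it.\<close>

lemma cyc_diff_add:
  assumes "a = b \<or> b = c \<or> a = c"
  shows "cyc_diff a b + cyc_diff b c = cyc_diff a c"
  using assms exhaust_mod3[of a] exhaust_mod3[of b] exhaust_mod3[of c]
  unfolding cyc_diff_def by auto

lemma third_mod3:
  fixes a b :: 3
  obtains c where "c \<noteq> a" "c \<noteq> b"
  using exhaust_mod3[of a] exhaust_mod3[of b] distinct_mod3 by metis

section \<open>Output counts and majority labels\<close>

text \<open>
  \<open>r i a v\<close> is the number of processors of the \<open>i\<close>-th component, of size \<open>c i\<close>, that output \<open>v\<close>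
  when all inputs in this component are \<open>a\<close>. Inputs \<open>x :: nat \<Rightarrow> 3\<close> matter only below \<open>k\<close>.
\<close>

locale component_counts =
  fixes k :: nat and c :: "nat \<Rightarrow> real" and r :: "nat \<Rightarrow> 3 \<Rightarrow> 3 \<Rightarrow> real"
  assumes r_nonneg: "\<And>i a v. i < k \<Longrightarrow> 0 \<le> r i a v"
    and sum_r: "\<And>i a. i < k \<Longrightarrow> (\<Sum>v\<in>UNIV. r i a v) = c i"
begin

definition total :: "(nat \<Rightarrow> 3) \<Rightarrow> 3 \<Rightarrow> real" where
  "total x v = (\<Sum>i<k. r i (x i) v)"

definition size :: real where
  "size = (\<Sum>i<k. c i)"

lemma r_le: "i < k \<Longrightarrow> r i a v \<le> c i"
  using member_le_sum[of v UNIV "r i a"] r_nonneg sum_r[of i a] by auto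

lemma total_nonneg: "0 \<le> total x v"
  unfolding total_def using r_nonneg by (intro sum_nonneg) auto

lemma sum_total: "(\<Sum>v\<in>UNIV. total x v) = size"
proof -
  have "(\<Sum>v\<in>UNIV. total x v) = (\<Sum>i<k. \<Sum>v\<in>UNIV. r i (x i) v)"
    unfolding total_def by (rule sum.swap)
  also have "\<dots> = size"
    unfolding size_def by (intro sum.cong) (auto simp: sum_r)
  finally show ?thesis .
qed

lemma total_cong: "(\<And>i. i < k \<Longrightarrow> x i = y i) \<Longrightarrow> total x = total y"
  unfolding total_def by (intro ext sum.cong) auto

lemma total_upd_le:
  assumes "j < k" "\<And>i. i \<noteq> j \<Longrightarrow> y i = x i"
  shows "total y v \<le> total x v + c j"
proof -
  have split: "total z v = r j (z j) v + (\<Sum>i\<in>{..<k}-{j}. r i (z i) v)" for z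
    unfolding total_def using assms(1) by (intro sum.remove) auto
  have "(\<Sum>i\<in>{..<k}-{j}. r i (y i) v) = (\<Sum>i\<in>{..<k}-{j}. r i (x i) v)"
    using assms(2) by (intro sum.cong) auto
  then show ?thesis
    using split[of x] split[of y] r_le[OF assms(1), of "y j" v] r_nonneg[OF assms(1), of "x j" v]
    by linarith
qed

end

text \<open>A counterexample to (a), reduced to its counts; these assumptions are refuted by
  \<open>no_small_components_majority\<close>.\<close>

locale small_components_majority = component_counts +
  fixes winner :: "(nat \<Rightarrow> 3) \<Rightarrow> 3"
  assumes small: "\<And>i. i < k \<Longrightarrow> c i \<le> size / 4"
    and winner_majority: "\<And>x. total x (winner x) > size / 2"
    and winner_const: "\<And>a. winner (\<lambda>_. a) = a"
begin

text \<open>Reflexive, so that the squares below include the degenerate ones and the triangles.\<close>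

definition adj :: "(nat \<Rightarrow> 3) \<Rightarrow> (nat \<Rightarrow> 3) \<Rightarrow> bool" where
  "adj x y \<longleftrightarrow> (\<exists>j<k. \<forall>i. i \<noteq> j \<longrightarrow> y i = x i)"

lemma adj_sym: "adj x y \<Longrightarrow> adj y x"
  unfolding adj_def by metis

lemma winner_unique:
  assumes "total x v > size / 2"
  shows "winner x = v"
proof (rule ccontr)
  assume *: "winner x \<noteq> v"
  have "sum (total x) {winner x, v} \<le> sum (total x) UNIV"
    by (intro sum_mono2) (auto simp: total_nonneg)
  then show False
    using * assms winner_majority[of x] sum_total[of x] by simp
qed

lemma winner_cong: "(\<And>i. i < k \<Longrightarrow> x i = y i) \<Longrightarrow> winner x = winner y"
  using total_cong[of x y] winner_majority[of y] winner_unique by metis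

lemma total_adj_winner:
  assumes "adj x y"
  shows "total x (winner y) > size / 4"
proof -
  obtain j where j: "j < k" "\<And>i. i \<noteq> j \<Longrightarrow> y i = x i"
    using assms unfolding adj_def by blast
  show ?thesis
    using total_upd_le[of j y x "winner y", OF j] small[OF j(1)] winner_majority[of y] by linarith
qed

text \<open>At \<open>x\<close>, its own label takes more than 1/2 of the outputs and the
  neighbour's label more than 1/4.\<close>

lemma total_third_less:
  assumes "adj x y" "winner x \<noteq> winner y" "w \<noteq> winner x" "w \<noteq> winner y"
  shows "total x w < size / 4"
  using sum_mod3[of "winner x" "winner y" w "total x"] sum_total[of x] assms(2-)
    total_adj_winner[OF assms(1)] winner_majority[of x] by auto

lemma winner_adj_adj:
  assumes "adj x y" "adj x z"
  shows "winner y = winner x \<or> winner x = winner z \<or> winner y = winner z"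
  using total_third_less[of x y "winner z"] total_adj_winner[of x z] assms by force

text \<open>Both sides equal the step along the diagonal from \<open>x\<close> to \<open>z\<close>:
  each of the corners \<open>y\<close> and \<open>w\<close> has \<open>x\<close> and
  \<open>z\<close> as neighbours, so \<open>winner_adj_adj\<close> applies to it.\<close>

lemma cyc_diff_square:
  assumes "adj x y" "adj y z" "adj x w" "adj w z"
  shows "cyc_diff (winner x) (winner y) + cyc_diff (winner y) (winner z) =
    cyc_diff (winner x) (winner w) + cyc_diff (winner w) (winner z)"
proof -
  have "cyc_diff (winner x) (winner y) + cyc_diff (winner y) (winner z) =
      cyc_diff (winner x) (winner z)"
    using winner_adj_adj[of y x z] assms adj_sym by (intro cyc_diff_add) blast
  moreover have "cyc_diff (winner x) (winner w) + cyc_diff (winner w) (winner z) =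
      cyc_diff (winner x) (winner z)"
    using winner_adj_adj[of w x z] assms adj_sym by (intro cyc_diff_add) blast
  ultimately show ?thesis by simp
qed

section \<open>Lifting the labels to integers\<close>

definition trunc :: "nat \<Rightarrow> (nat \<Rightarrow> 3) \<Rightarrow> nat \<Rightarrow> 3" where
  "trunc i x = (\<lambda>j. if j < i then x j else 0)"

text \<open>The label steps are summed along one fixed path from the zero point towards
  \<open>x\<close>, which sets the coordinates in increasing order.\<close>

definition lift :: "nat \<Rightarrow> (nat \<Rightarrow> 3) \<Rightarrow> int" where
  "lift m x = (\<Sum>i<m. cyc_diff (winner (trunc i x)) (winner (trunc (Suc i) x)))"

lemma adj_trunc_Suc: "i < k \<Longrightarrow> adj (trunc i x) (trunc (Suc i) x)"
  unfolding adj_def trunc_def by (intro exI[of _ i]) auto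

lemma adj_trunc: "adj x y \<Longrightarrow> adj (trunc i x) (trunc i y)"
  unfolding adj_def trunc_def by auto

text \<open>The paths towards \<open>x\<close> and \<open>y\<close> are the sides of a ladder with
  rungs from \<open>trunc i x\<close> to \<open>trunc i y\<close>. Each step of the induction adds
  one square; the first rung is degenerate.\<close>

lemma lift_diff_trunc:
  assumes "adj x y" "m \<le> k"
  shows "lift m y - lift m x = cyc_diff (winner (trunc m x)) (winner (trunc m y))"
  using assms(2)
proof (induction m)
  case 0
  then show ?case by (simp add: lift_def trunc_def cyc_diff_def)
next
  case (Suc m)
  have "cyc_diff (winner (trunc m x)) (winner (trunc m y)) +
      cyc_diff (winner (trunc m y)) (winner (trunc (Suc m) y)) =
      cyc_diff (winner (trunc m x)) (winner (trunc (Suc m) x)) +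
      cyc_diff (winner (trunc (Suc m) x)) (winner (trunc (Suc m) y))"
    using Suc.prems by (intro cyc_diff_square adj_trunc adj_trunc_Suc assms(1)) auto
  then show ?case
    using Suc by (simp add: lift_def)
qed

lemma lift_diff: "adj x y \<Longrightarrow> lift k y - lift k x = cyc_diff (winner x) (winner y)"
  using lift_diff_trunc[of x y k] winner_cong[of "trunc k x" x] winner_cong[of "trunc k y" y]
  by (simp add: trunc_def)

text \<open>Modulo 3 the sum telescopes, so the lift determines the label.\<close>

lemma of_int_lift: "of_int (lift m x) = winner (trunc m x) - winner (\<lambda>_. 0)"
  by (induction m) (auto simp: lift_def trunc_def of_int_cyc_diff)

lemma lift_eq_imp_winner_eq:
  assumes "lift k x = lift k y"
  shows "winner x = winner y"
  using of_int_lift[of k x] of_int_lift[of k y] assms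
    winner_cong[of "trunc k x" x] winner_cong[of "trunc k y" y]
  by (simp add: trunc_def)

end

section \<open>Complementary paths between constant points\<close>

lemma int_sign_change:
  fixes d :: "nat \<Rightarrow> int"
  assumes "d 0 > 0" "d k < 0" "\<And>i. i \<le> k \<Longrightarrow> d i \<noteq> 0"
  obtains i where "i < k" "d i > 0" "d (Suc i) < 0"
proof -
  have "\<exists>i<k. d i > 0 \<and> d (Suc i) < 0"
    using assms
  proof (induction k)
    case (Suc k)
    show ?case
    proof (cases "d k < 0")
      case True
      then show ?thesis
        using Suc.IH Suc.prems le_SucI less_SucI by metis
    next
      case False
      then have "d k > 0"
        using Suc.prems(3)[of k] by simp
      then show ?thesis
        using Suc.prems(2) by blast
    qed
  qed auto
  then show ?thesis using that by blast
qed

context small_components_majority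
begin

definition switch :: "3 \<Rightarrow> 3 \<Rightarrow> nat \<Rightarrow> nat \<Rightarrow> 3" where
  "switch a b i = (\<lambda>j. if j < i then b else a)"

lemma adj_switch: "i < k \<Longrightarrow> adj (switch a b i) (switch a b (Suc i))"
  unfolding adj_def switch_def by (intro exI[of _ i]) auto

lemma switch_0: "switch a b 0 = (\<lambda>_. a)"
  unfolding switch_def by simp

lemma winner_switch_k: "winner (switch a b k) = b"
  using winner_cong[of "switch a b k" "\<lambda>_. b"] by (simp add: winner_const switch_def)

lemma lift_switch_k: "lift k (switch a b k) = lift k (\<lambda>_. b)"
  unfolding lift_def
  by (intro sum.cong refl arg_cong2[of _ _ _ _ cyc_diff] winner_cong) (auto simp: trunc_def switch_def)

text \<open>At every time each component has input \<open>a\<close> on one path and \<open>b\<close>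
  on the other.\<close>

lemma total_switch_add:
  "total (switch a b i) v + total (switch b a i) v = total (\<lambda>_. a) v + total (\<lambda>_. b) v"
  unfolding total_def sum.distrib[symmetric] switch_def by (intro sum.cong) auto

lemma winner_switch:
  assumes "a \<noteq> b"
  shows "winner (switch a b m) \<in> {a, b}"
proof (rule ccontr)
  assume third: "winner (switch a b m) \<notin> {a, b}"
  define S where "S v = total (\<lambda>_. a) v + total (\<lambda>_. b) v" for v
  define p where "p = switch a b"
  define q where "q = switch b a"
  have pq: "total (p i) v + total (q i) v = S v" for i v
    unfolding S_def p_def q_def by (rule total_switch_add)
  have S_sum: "(\<Sum>v\<in>UNIV. S v) = 2 * size"
    unfolding S_def sum.distrib sum_total by simp
  \<comment> \<open>Each of the three labels wins at a constant point or at \<open>p m\<close>, and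
    \<open>S\<close> dominates the counts at all of these.\<close>
  have S_gt: "S v > size / 2" for v
  proof -
    have "v = a \<or> v = b \<or> v = winner (p m)"
      using third assms exhaust_mod3[of a] exhaust_mod3[of b] exhaust_mod3[of v]
        exhaust_mod3[of "winner (p m)"] distinct_mod3 unfolding p_def by (metis insert_iff)
    moreover have "S v \<ge> total (\<lambda>_. a) v" "S v \<ge> total (\<lambda>_. b) v" "S v \<ge> total (p m) v"
      using pq[of m v] total_nonneg[of "\<lambda>_. a" v] total_nonneg[of "\<lambda>_. b" v]
        total_nonneg[of "q m" v]
      unfolding S_def by linarith+
    ultimately show ?thesis
      using winner_majority[of "p m"] winner_majority[of "\<lambda>_. a"] winner_majority[of "\<lambda>_. b"]
      by (auto simp: winner_const)
  qed
  \<comment> \<open>A common label would have more than \<open>size\<close> in \<open>S\<close> and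
    the other two more than \<open>size / 2\<close> each, exceeding the sum
    \<open>2 * size\<close>.\<close>
  have neq: "winner (p i) \<noteq> winner (q i)" for i
  proof
    assume eq: "winner (p i) = winner (q i)"
    obtain u where u: "u \<noteq> winner (p i)"
      using third_mod3 by blast
    obtain w where w: "w \<noteq> winner (p i)" "w \<noteq> u"
      using third_mod3 by blast
    have "S (winner (p i)) > size"
      using winner_majority[of "p i"] winner_majority[of "q i"] pq[of i] eq
      by (metis add_strict_mono field_sum_of_halves)
    then show False
      using sum_mod3[of "winner (p i)" u w S] u w S_sum S_gt[of u] S_gt[of w] by simp
  qed
  define d where "d i = lift k (p i) - lift k (q i)" for i
  have d_nz: "d i \<noteq> 0" for i
    using neq[of i] lift_eq_imp_winner_eq[of "p i" "q i"] by (auto simp: d_def)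
  have no_swap: False if "i < k" and opp: "d i > 0 \<and> d (Suc i) < 0 \<or> d i < 0 \<and> d (Suc i) > 0" for i
  proof -
    have adj_p: "adj (p i) (p (Suc i))" and adj_q: "adj (q i) (q (Suc i))"
      using that adj_switch by (auto simp: p_def q_def)
    \<comment> \<open>Each lift moves by at most 1, so \<open>d\<close> can jump over 0 only between
      1 and -1, with both lifts moving in opposite directions and exchanging their values.\<close>
    have "lift k (p (Suc i)) = lift k (q i)" "lift k (q (Suc i)) = lift k (p i)"
      using opp lift_diff[OF adj_p] lift_diff[OF adj_q]
        abs_cyc_diff_le[of "winner (p i)" "winner (p (Suc i))"]
        abs_cyc_diff_le[of "winner (q i)" "winner (q (Suc i))"]
      unfolding d_def by linarith+
    then have swap: "winner (p (Suc i)) = winner (q i)" "winner (q (Suc i)) = winner (p i)"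
      using lift_eq_imp_winner_eq by blast+
    obtain w where w: "w \<noteq> winner (p i)" "w \<noteq> winner (q i)"
      using third_mod3 by blast
    have "total (p i) w < size / 4" "total (q i) w < size / 4"
      using total_third_less[OF adj_p, of w] total_third_less[OF adj_q, of w] swap w neq[of i]
      by auto
    then show False
      using pq[of i w] S_gt[of w] by linarith
  qed
  \<comment> \<open>Each path ends where the other begins.\<close>
  have "d k = - d 0"
    unfolding d_def p_def q_def by (simp add: lift_switch_k switch_0)
  consider "d 0 > 0" | "- d 0 > 0"
    using d_nz[of 0] by linarith
  then show False
  proof cases
    case 1
    then obtain i where "i < k" "d i > 0" "d (Suc i) < 0"
      using int_sign_change[of d k] d_nz \<open>d k = - d 0\<close> by auto
    then show False
      using no_swap by blast
  next
    case 2
    then obtain i where "i < k" "- d i > 0" "- d (Suc i) < 0"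
      using int_sign_change[of "\<lambda>i. - d i" k] d_nz \<open>d k = - d 0\<close> by auto
    then show False
      using no_swap[of i] by simp
  qed
qed

lemma lift_const_diff:
  assumes "a \<noteq> b"
  shows "lift k (\<lambda>_. b) - lift k (\<lambda>_. a) = cyc_diff a b"
proof -
  have "lift k (switch a b i) - lift k (\<lambda>_. a) = cyc_diff a (winner (switch a b i))" if "i \<le> k" for i
    using that
  proof (induction i)
    case 0
    then show ?case by (simp add: switch_0 winner_const cyc_diff_def)
  next
    case (Suc i)
    \<comment> \<open>All three labels lie in {a, b}, so two of them coincide.\<close>
    have "cyc_diff a (winner (switch a b i)) +
        cyc_diff (winner (switch a b i)) (winner (switch a b (Suc i))) =
        cyc_diff a (winner (switch a b (Suc i)))"
      using winner_switch[OF assms, of i] winner_switch[OF assms, of "Suc i"] Suc.prems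
      by (intro cyc_diff_add) auto
    then show ?case
      using Suc lift_diff[OF adj_switch[of i a b]] by simp
  qed
  from this[of k] show ?thesis
    by (simp add: lift_switch_k winner_switch_k)
qed

lemma no_small_components_majority: False
proof -
  have "cyc_diff 0 1 + cyc_diff 1 2 + cyc_diff 2 0 = 0"
    using lift_const_diff[of 0 1] lift_const_diff[of 1 2] lift_const_diff[of 2 0] by simp
  then show False
    by (simp add: cyc_diff_def)
qed

end

section \<open>From protocols to output counts\<close>

context network
begin

lemma component_eq: "S \<in> components G \<Longrightarrow> i \<in> S \<Longrightarrow> component G i = S"
  unfolding scc_of_def sccs_verts_def by blast

lemma Union_components: "\<Union> (components G) = verts G"
  using sccs_verts_subsets in_scc_of_self scc_of_in_sccs_verts by blast

lemma finite_components: "S \<in> components G \<Longrightarrow> finite S"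
  using sccs_verts_subsets finite_verts by (metis finite_subset)

lemma card_verts: "card (verts G) = (\<Sum>S\<in>components G. card S)"
proof -
  have "card (\<Union> (components G)) = (\<Sum>S\<in>components G. card S)"
    using sccs_verts_disjoint finite_components
    by (intro card_Union_disjoint) (auto simp: pairwise_def disjnt_def)
  then show ?thesis
    by (simp add: Union_components)
qed

lemma components_nonempty: "components G \<noteq> {}"
  using verts_nonempty Union_components by auto

lemma card_component_le: "S \<in> components G \<Longrightarrow> card S \<le> largest_component_size G"
  unfolding largest_component_size_def using finite_sccs_verts by (intro Max_ge) auto

lemma largest_component:
  obtains L where "L \<in> components G" "card L = largest_component_size G"
  using Max_in[of "card ` components G"] finite_sccs_verts components_nonempty
  unfolding largest_component_size_def by fastforce

lemma card_verts_filter: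
  "card {i \<in> verts G. Q i} = (\<Sum>S\<in>components G. card {i \<in> S. Q i})"
proof -
  have "{i \<in> verts G. Q i} = (\<Union>S\<in>components G. {i \<in> S. Q i})"
    using Union_components by blast
  also have "card \<dots> = (\<Sum>S\<in>components G. card {i \<in> S. Q i})"
    using finite_sccs_verts finite_components sccs_verts_disjoint
    by (intro card_UN_disjoint) auto
  finally show ?thesis .
qed

lemma majority_imp_large_component:
  fixes V :: "'v set"
  assumes V: "card V = 3" and P: "successful_majority_agreement V G P"
  shows "real (largest_component_size G) > real (card (verts G)) / 4"
proof (rule ccontr)
  assume small: "\<not> ?thesis"
  have "finite V"
    using V by (metis card.infinite zero_neq_numeral)
  then obtain \<phi> :: "3 \<Rightarrow> 'v" where \<phi>: "bij_betw \<phi> UNIV V"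
    using V finite_same_card_bij[of "UNIV :: 3 set" V] by auto
  then have \<phi>_in: "\<phi> a \<in> V" and \<phi>_eq: "\<phi> a = \<phi> b \<longleftrightarrow> a = b" for a b
    by (auto simp: bij_betw_def inj_eq)
  define k where "k = card (components G)"
  obtain e where e: "bij_betw e {..<k} (components G)"
    using finite_sccs_verts k_def bij_betw_from_nat_into_finite lessThan_atLeast0 ex_bij_betw_nat_finite by metis
  define idx where "idx i = inv_into {..<k} e (component G i)" for i
  have e_comp: "e j \<in> components G" if "j < k" for j
    using e that by (auto simp: bij_betw_def)
  have comp_e: "component G i = e j" and idx_e: "idx i = j" if "j < k" "i \<in> e j" for i j
  proof -
    show "component G i = e j"
      using component_eq e_comp that by blast
    then show "idx i = j"
      using e that by (simp add: idx_def bij_betw_inv_into_left)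
  qed
  define out where "out j a i = P i (restrict (\<lambda>_. \<phi> a) (e j))" for j a i
  define r where "r j a v = real (card {i \<in> e j. out j a i = \<phi> v})" for j a v
  define c where "c j = real (card (e j))" for j
  have out_in: "out j a i \<in> V" if "j < k" "i \<in> e j" for j a i
  proof -
    have "i \<in> verts G"
      using that e_comp Union_components by blast
    then have "P i \<in> (component G i \<rightarrow>\<^sub>E V) \<rightarrow> V"
      using P unfolding successful_majority_agreement_def protocols_def by blast
    then show ?thesis
      using comp_e[OF that] \<phi>_in unfolding out_def by auto
  qed
  have sum_r: "(\<Sum>v\<in>UNIV. r j a v) = c j" if "j < k" for j a
  proof -
    have "e j = (\<Union>v\<in>UNIV. {i \<in> e j. out j a i = \<phi> v})"
      using out_in[OF that] \<phi> by (auto simp: bij_betw_def)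
    also have "card \<dots> = (\<Sum>v\<in>UNIV. card {i \<in> e j. out j a i = \<phi> v})"
      using finite_components[OF e_comp[OF that]] \<phi>_eq by (intro card_UN_disjoint) auto
    finally show ?thesis
      unfolding r_def c_def by simp
  qed
  interpret component_counts k c r
    using sum_r by unfold_locales (simp_all add: r_def)
  have size_eq: "size = real (card (verts G))"
    unfolding size_def c_def card_verts using sum.reindex_bij_betw[OF e, of "\<lambda>S. real (card S)"]
    by simp
  define inp where "inp x = restrict (\<lambda>i. \<phi> (x (idx i))) (verts G)" for x
  have total_eq: "total x v = real (card {i \<in> verts G. proc_output G P (inp x) i = \<phi> v})" for x v
  proof -
    have out_eq: "proc_output G P (inp x) i = out j (x j) i" if "j < k" "i \<in> e j" for i j
    proof -
      have "e j \<subseteq> verts G"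
        using e_comp[OF that(1)] Union_components by blast
      then have "restrict (inp x) (e j) = restrict (\<lambda>_. \<phi> (x j)) (e j)"
        using idx_e[OF that(1)] by (auto simp: inp_def restrict_def fun_eq_iff)
      then show ?thesis
        unfolding proc_output_def out_def comp_e[OF that] by simp
    qed
    have "card {i \<in> verts G. proc_output G P (inp x) i = \<phi> v} =
        (\<Sum>j<k. card {i \<in> e j. proc_output G P (inp x) i = \<phi> v})"
      unfolding card_verts_filter by (rule sum.reindex_bij_betw[OF e, symmetric])
    also have "\<dots> = (\<Sum>j<k. card {i \<in> e j. out j (x j) i = \<phi> v})"
      by (intro sum.cong arg_cong[where f = card]) (auto simp: out_eq)
    finally show ?thesis
      unfolding total_def r_def by simp
  qed
  \<comment> \<open>Validity is recorded only for literally constant \<open>x\<close>; independence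
    of the coordinates from \<open>k\<close> on follows by \<open>winner_cong\<close>.\<close>
  have "\<exists>v. total x v > size / 2 \<and> (\<forall>a. x = (\<lambda>_. a) \<longrightarrow> v = a)" for x
  proof -
    have "inp x \<in> verts G \<rightarrow>\<^sub>E V"
      using \<phi>_in by (auto simp: inp_def)
    then obtain w where w: "w \<in> V"
      "real (card {i \<in> verts G. proc_output G P (inp x) i = w}) > real (card (verts G)) / 2"
      "\<forall>c\<in>V. (\<forall>i\<in>verts G. inp x i = c) \<longrightarrow> w = c"
      using P unfolding successful_majority_agreement_def by blast
    obtain v where v: "w = \<phi> v"
      using w(1) \<phi> by (auto simp: bij_betw_def)
    have "v = a" if "x = (\<lambda>_. a)" for a
    proof -
      have "w = \<phi> a"
        using w(3) \<phi>_in that by (simp add: inp_def)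
      then show ?thesis
        by (simp add: v \<phi>_eq)
    qed
    then show ?thesis
      using w(2) by (auto simp: v total_eq size_eq)
  qed
  then obtain winner where winner:
    "\<And>x. total x (winner x) > size / 2" "\<And>a. winner (\<lambda>_. a) = a"
    by metis
  interpret small_components_majority k c r winner
  proof
    fix j assume "j < k"
    then have "c j \<le> real (largest_component_size G)"
      using card_component_le e_comp by (simp add: c_def)
    then show "c j \<le> size / 4"
      using small by (simp add: size_eq)
  qed (fact winner)+
  show False
    by (rule no_small_components_majority)
qed

section \<open>A protocol for a large component\<close>

lemma large_component_imp_majority:
  fixes V :: "'v set"
  assumes V: "card V = 3" and n: "card (verts G) = largest_component_size G + 3 * m"
    and m: "m < largest_component_size G"
  shows "\<exists>P. successful_majority_agreement V G P"
proof -
  obtain L where L: "L \<in> components G" "card L = largest_component_size G"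
    by (rule largest_component)
  obtain a b c where abc: "V = {a, b, c}" "a \<noteq> b" "b \<noteq> c" "a \<noteq> c"
    using V card_3_iff by metis
  have L_sub: "L \<subseteq> verts G"
    using L(1) sccs_verts_subsets by blast
  obtain l where l: "l \<in> L"
    using L(2) m by (metis all_not_in_conv card.empty less_nat_zero_code)
  define U where "U = verts G - L"
  have U: "finite U" "card U = 3 * m"
    using n L L_sub finite_components by (simp_all add: U_def card_Diff_subset)
  obtain A where A: "A \<subseteq> U" "card A = m"
    using U obtain_subset_with_card_n[of m U] by auto
  have UA: "finite (U - A)" "card (U - A) = 2 * m"
    using U A by (simp_all add: card_Diff_subset finite_subset)
  obtain B where B: "B \<subseteq> U - A" "card B = m"
    using UA obtain_subset_with_card_n[of m "U - A"] by auto
  have UAB: "card (U - A - B) = m"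
    using UA B by (simp add: card_Diff_subset finite_subset)
  \<comment> \<open>All of \<open>L\<close> copies the input of its fixed member \<open>l\<close>,
    which makes validity automatic.\<close>
  define P where "P i s = (if i \<in> L then s l else if i \<in> A then a else if i \<in> B then b else c)"
    for i :: 'a and s :: "'a \<Rightarrow> 'v"
  have comp_L: "component G i = L" if "i \<in> L" for i
    using component_eq[OF L(1) that] .
  have "P \<in> protocols V G"
    unfolding protocols_def
  proof (intro Pi_I)
    fix i s assume "s \<in> component G i \<rightarrow>\<^sub>E V"
    then have "s l \<in> V" if "i \<in> L"
      using comp_L[OF that] l by (auto dest: PiE_mem)
    then show "P i s \<in> V"
      by (simp add: P_def abc(1))
  qed
  moreover have "real (card {i \<in> verts G. proc_output G P inp i = inp l}) > real (card (verts G)) / 2"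
    if inp: "inp \<in> verts G \<rightarrow>\<^sub>E V" for inp
  proof -
    have out_L: "proc_output G P inp i = inp l" if "i \<in> L" for i
      using that l comp_L by (simp add: proc_output_def P_def)
    have out_U: "proc_output G P inp i = (if i \<in> A then a else if i \<in> B then b else c)"
      if "i \<in> U" for i
      using that by (simp add: proc_output_def P_def U_def)
    obtain C where C: "C \<subseteq> U" "card C = m" "\<And>i. i \<in> C \<Longrightarrow> proc_output G P inp i = inp l"
    proof -
      have "inp l = a \<or> inp l = b \<or> inp l = c"
        using inp l L_sub abc(1) by blast
      then show ?thesis
      proof (elim disjE)
        assume "inp l = a"
        then show ?thesis
          using A out_U abc by (intro that[of A]) (auto dest: subsetD)
      next
        assume "inp l = b"
        then show ?thesis
          using B out_U abc by (intro that[of B]) (auto dest: subsetD)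
      next
        assume "inp l = c"
        then show ?thesis
          using UAB out_U abc by (intro that[of "U - A - B"]) auto
      qed
    qed
    have "card L + card C = card (L \<union> C)"
      using C(1) U L finite_components
      by (intro card_Un_disjoint[symmetric]) (auto simp: U_def intro: finite_subset)
    also have "\<dots> \<le> card {i \<in> verts G. proc_output G P inp i = inp l}"
      using out_L C L_sub by (intro card_mono) (auto simp: U_def)
    \<comment> \<open>With h = \<open>card L\<close>, the value \<open>inp l\<close> has at least h
      + m outputs, and h + m > (h + 3m)/2 because m < h.\<close>
    finally show ?thesis
      using n m C(2) L(2) by simp
  qed
  ultimately have "successful_majority_agreement V G P"
    unfolding successful_majority_agreement_def using l L_sub by blast
  then show ?thesis
    by blast
qed

end

theorem mainTheorem4:
  fixes V :: "'v set" and G :: "('p, 'e) pre_digraph" and h :: nat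
  assumes "card V = 3"
    and "network G"
    and "h = largest_component_size G"
  shows "((\<exists>P. successful_majority_agreement V G P) \<longrightarrow> real h > real (card (verts G)) / 4) \<and>
         (real h > real (card (verts G)) / 4 \<and> (real (card (verts G)) - real h) / 3 \<in> \<int> \<longrightarrow>
          (\<exists>P. successful_majority_agreement V G P))"
proof -
  interpret network G by fact
  have "\<exists>P. successful_majority_agreement V G P"
    if large: "real h > real (card (verts G)) / 4"
      and int: "(real (card (verts G)) - real h) / 3 \<in> \<int>"
  proof -
    obtain L where "L \<in> components G" "card L = h"
      using largest_component assms(3) by metis
    then have "h \<le> card (verts G)"
      using sccs_verts_subsets finite_verts card_mono by metis
    \<comment> \<open>An integer quotient is a natural number here because h is at most the number
      of processors.\<close>
    then have "(real (card (verts G)) - real h) / 3 \<in> \<nat>"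
      using int by (auto simp: Nats_altdef2)
    then obtain m where "(real (card (verts G)) - real h) / 3 = real m"
      by (auto elim: Nats_cases)
    then have "real (card (verts G)) = real (h + 3 * m)"
      by simp
    then have "card (verts G) = h + 3 * m"
      by (rule of_nat_eq_iff[THEN iffD1])
    \<comment> \<open>The bound h > (h + 3m)/4 says exactly that m < h.\<close>
    then show ?thesis
      using large assms(1,3) large_component_imp_majority[of V m] by simp
  qed
  then show ?thesis
    using majority_imp_large_component assms(1,3) by blast
qed

end
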